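(* Let $n$ be an even positive integer and $m$ a positive integer, and let $y_1,\ldots,y_n$ be complex numbers with $y_1+\cdots+y_n=0$. Then for all $z\in\mathbb{C}$, \[ \sum_{k=0}^{mn-1}\prod_{j=1}^{n}\vartheta_1\!\left(z+y_j+\tfrac{k\pi}{mn}\Big|\tau\right)=R_1(m,n;\tau)\,\vartheta_3(mnz\,|\,m^2n\tau), \] where \[ R_1(m,n;\tau)=mn\,q^{-\frac{n}{4}}\sum_{\substack{r_1,\ldots,r_n\in\mathbb{Z}\\ r_1+\cdots+r_n=\frac n2}}q^{r_1^2+\cdots+r_n^2}e^{-2i(r_1y_1+\cdots+r_ny_n)}. \]
   Context: Throughout, $\tau\in\mathbb{C}$ with $\Im(\tau)>0$, $q=e^{\pi i\tau}$, and $q^{\alpha}$ means $e^{\pi i\alpha\tau}$ for real $\alpha$. The Jacobi theta functions are $\vartheta_1(z|\tau)=-iq^{1/4}\sum_{n\in\mathbb{Z}}(-1)^nq^{n(n+1)}e^{(2n+1)iz}$ and $\vartheta_3(z|\tau)=\sum_{n\in\mathbb{Z}}q^{n^2}e^{2niz}$; $\vartheta_3(z|m^2n\tau)$ denotes $\vartheta_3$ with $\tau$ replaced by $m^2n\tau$. *)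

theory Defs
  imports "HOL-Analysis.Analysis"
begin

text \<open>
  The nome is \<open>q = exp (\<pi> \<i> \<tau>)\<close>; its powers \<open>q\<^sup>\<alpha>\<close> for real \<open>\<alpha>\<close> are defined through \<open>\<tau>\<close> rather than
  through a branch of the complex logarithm of \<open>q\<close>.
\<close>

definition qpow :: "complex \<Rightarrow> real \<Rightarrow> complex" where
  "qpow \<tau> \<alpha> = exp (of_real pi * \<i> * of_real \<alpha> * \<tau>)"

definition jacobi_theta1 :: "complex \<Rightarrow> complex \<Rightarrow> complex" where
  "jacobi_theta1 z \<tau> = - \<i> * qpow \<tau> (1/4) *
     (\<Sum>\<^sub>\<infinity>n::int. (-1) powi n * qpow \<tau> (of_int (n * (n + 1))) * exp (of_int (2 * n + 1) * \<i> * z))"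

definition jacobi_theta3 :: "complex \<Rightarrow> complex \<Rightarrow> complex" where
  "jacobi_theta3 z \<tau> =
     (\<Sum>\<^sub>\<infinity>n::int. qpow \<tau> (of_int (n\<^sup>2)) * exp (of_int (2 * n) * \<i> * z))"

text \<open>
  Integer tuples \<open>(r\<^sub>1, \<dots>, r\<^sub>n)\<close> are extensional functions on \<open>{1..n}\<close>, so that each tuple is counted
  exactly once. The index set is as intended for even \<open>n\<close>, where \<open>n div 2\<close> is the exact half.
\<close>

definition R1 :: "nat \<Rightarrow> nat \<Rightarrow> (nat \<Rightarrow> complex) \<Rightarrow> complex \<Rightarrow> complex" where
  "R1 m n y \<tau> = of_nat (m * n) * qpow \<tau> (- (real n / 4)) *
     (\<Sum>\<^sub>\<infinity>r \<in> {r \<in> {1..n} \<rightarrow>\<^sub>E (UNIV :: int set). (\<Sum>j=1..n. r j) = int (n div 2)}.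
        qpow \<tau> (of_int (\<Sum>j=1..n. (r j)\<^sup>2)) * exp (- 2 * \<i> * (\<Sum>j=1..n. of_int (r j) * y j)))"

end

theory Submission
  imports Defs
begin

text \<open>
  Multiplying out the theta series turns the product into a sum over integer tuples \<open>(r\<^sub>1, \<dots>, r\<^sub>n)\<close>.
  Summing over \<open>k\<close> is a root-of-unity filter that keeps exactly the tuples for which \<open>m n\<close> divides
  \<open>r\<^sub>1 + \<dots> + r\<^sub>n + n / 2\<close>; call the quotient \<open>N\<close>. The substitution \<open>r\<^sub>j = m N - t\<^sub>j\<close> then makes the
  summand split into a factor in \<open>N\<close>, giving the theta function on the right, and a factor in \<open>t\<close>
  with \<open>t\<^sub>1 + \<dots> + t\<^sub>n = n / 2\<close>, giving \<open>R\<^sub>1\<close>.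
\<close>

section \<open>Powers of the nome\<close>

lemma qpow_add: "qpow \<tau> (a + b) = qpow \<tau> a * qpow \<tau> b"
  by (simp add: qpow_def algebra_simps exp_add)

lemma qpow_sum: "finite A \<Longrightarrow> qpow \<tau> (\<Sum>x\<in>A. f x) = (\<Prod>x\<in>A. qpow \<tau> (f x))"
  by (induction A rule: finite_induct) (simp_all add: qpow_add, simp add: qpow_def)

lemma qpow_power: "qpow \<tau> a ^ n = qpow \<tau> (of_nat n * a)"
  by (simp add: qpow_def exp_of_nat_mult [symmetric] algebra_simps)

lemma qpow_of_nat_mult: "qpow (of_nat k * \<tau>) a = qpow \<tau> (of_nat k * a)"
  by (simp add: qpow_def algebra_simps)

section \<open>Absolute convergence of the theta series and of its expanded products\<close>

lemma summable_on_exp_minus_abs_int: "(\<lambda>r::int. exp (- \<bar>real_of_int r\<bar>)) summable_on UNIV"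
proof -
  have "(\<lambda>k. exp (-1 :: real) ^ k) summable_on (UNIV :: nat set)"
    by (rule norm_summable_imp_summable_on) (simp add: norm_power summable_geometric)
  then have nat: "(\<lambda>k. exp (- real k)) summable_on (UNIV :: nat set)"
    by (simp add: exp_of_nat_mult [symmetric])
  have 1: "(\<lambda>r::int. exp (- \<bar>real_of_int r\<bar>)) summable_on {0..}"
    by (rule summable_on_reindex_bij_witness [of UNIV nat int, THEN iffD1, OF _ _ _ _ _ nat]) auto
  have 2: "(\<lambda>r::int. exp (- \<bar>real_of_int r\<bar>)) summable_on {..0}"
    by (rule summable_on_reindex_bij_witness
          [of UNIV "\<lambda>r. nat (- r)" "\<lambda>k. - int k", THEN iffD1, OF _ _ _ _ _ nat]) auto
  have "(\<lambda>r::int. exp (- \<bar>real_of_int r\<bar>)) summable_on ({0..} \<union> ({..0} - {0}))"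
    by (rule summable_on_Un_disjoint [OF 1 summable_on_subset_banach [OF 2]]) auto
  also have "{0..} \<union> ({..0} - {0}) = (UNIV :: int set)"
    by auto
  finally show ?thesis .
qed

text \<open>The prefactor \<open>- \<i> * qpow \<tau> (1/4)\<close> of the series is left out; its
  n-th power is collected once as \<open>C\<close>.\<close>

definition theta1_term :: "complex \<Rightarrow> complex \<Rightarrow> int \<Rightarrow> complex" where
  "theta1_term \<tau> w r =
     (-1) powi r * qpow \<tau> (of_int (r * (r + 1))) * exp (of_int (2 * r + 1) * \<i> * w)"

text \<open>The norm is the exponential of a quadratic in r with leading coefficient -\<pi> Im
  \<tau> < 0, so a constant multiple of exp (-|r|) dominates it.\<close>

lemma theta1_term_abs_summable:
  assumes "Im \<tau> > 0"
  shows "(\<lambda>r. norm (theta1_term \<tau> w r)) summable_on UNIV"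
proof -
  define A where "A = pi * Im \<tau>"
  define b where "b = Im w"
  \<comment> \<open>\<open>L\<close> adds up all linear growth in |x|: \<open>A\<close> from r (r +
    1), 2 |b| from the exponential in w, and 1 for the decay that must be left over.\<close>
  define L where "L = A + 2 * \<bar>b\<bar> + 1"
  have "A > 0"
    using assms by (simp add: A_def)
  have norm_eq: "norm (theta1_term \<tau> w r) = exp (- A * (r * (r + 1)) - (2 * r + 1) * b)" for r
    by (simp add: theta1_term_def qpow_def norm_mult norm_power_int A_def b_def
        exp_add [symmetric] algebra_simps)
  have bound: "- A * (x * (x + 1)) - (2 * x + 1) * b \<le> (L\<^sup>2 / (4 * A) + \<bar>b\<bar>) + - \<bar>x\<bar>" for x :: real
  proof -
    \<comment> \<open>Completing the square absorbs the linear part into the quadratic one at the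
      cost of a constant.\<close>
    have "0 \<le> (2 * A * \<bar>x\<bar> - L)\<^sup>2 / (4 * A)"
      using \<open>A > 0\<close> by simp
    also have "\<dots> = A * x\<^sup>2 - L * \<bar>x\<bar> + L\<^sup>2 / (4 * A)"
      using \<open>A > 0\<close> by (simp add: field_simps power2_eq_square)
    finally have sq: "L * \<bar>x\<bar> \<le> A * x\<^sup>2 + L\<^sup>2 / (4 * A)"
      by simp
    have "- (A * x) \<le> A * \<bar>x\<bar>"
      using \<open>A > 0\<close> by (metis abs_ge_minus_self abs_mult abs_of_pos)
    moreover have "- (x * b) \<le> \<bar>b\<bar> * \<bar>x\<bar>"
      by (metis abs_ge_minus_self abs_mult mult.commute)
    moreover have "L * \<bar>x\<bar> = A * \<bar>x\<bar> + 2 * (\<bar>b\<bar> * \<bar>x\<bar>) + \<bar>x\<bar>"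
      by (simp add: L_def algebra_simps)
    moreover have "- A * (x * (x + 1)) - (2 * x + 1) * b = - (A * x\<^sup>2) - A * x - 2 * (x * b) - b"
      by (simp add: algebra_simps power2_eq_square)
    ultimately show ?thesis
      using sq by linarith
  qed
  show ?thesis
  proof (rule Infinite_Sum.abs_summable_on_comparison_test')
    show "(\<lambda>r. exp (L\<^sup>2 / (4 * A) + \<bar>b\<bar>) * exp (- \<bar>real_of_int r\<bar>)) summable_on (UNIV :: int set)"
      by (intro summable_on_cmult_right summable_on_exp_minus_abs_int)
    show "norm (theta1_term \<tau> w r) \<le> exp (L\<^sup>2 / (4 * A) + \<bar>b\<bar>) * exp (- \<bar>real_of_int r\<bar>)" for r
      unfolding norm_eq exp_add [symmetric] exp_le_cancel_iff using bound [of "of_int r"] by simp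
  qed
qed

text \<open>Needed to sum the expanded product over tuples, restrict it to a subset and rearrange
  it. Countability comes from the measure-theoretic notion of absolute summability through which the
  proof passes.\<close>

lemma summable_on_prod_PiE_countable:
  fixes f :: "'a \<Rightarrow> 'b \<Rightarrow> complex"
  assumes "finite A" "\<And>x. x \<in> A \<Longrightarrow> countable (B x)"
    and "\<And>x. x \<in> A \<Longrightarrow> (\<lambda>t. norm (f x t)) summable_on B x"
  shows "(\<lambda>g. \<Prod>x\<in>A. f x (g x)) summable_on PiE A B"
proof -
  have "Infinite_Set_Sum.abs_summable_on (\<lambda>g. \<Prod>x\<in>A. f x (g x)) (PiE A B)"
    by (rule abs_summable_on_prod_PiE) (use assms in \<open>simp_all add: abs_summable_equivalent [symmetric]\<close>)
  then show ?thesis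
    unfolding abs_summable_equivalent [symmetric] by (rule abs_summable_summable)
qed

lemma power_int_sum:
  fixes a :: "'a :: field"
  assumes "finite A" "a \<noteq> 0"
  shows "a powi (\<Sum>x\<in>A. f x) = (\<Prod>x\<in>A. a powi f x)"
  using assms(1) by (induction A rule: finite_induct) (simp_all add: power_int_add assms(2))

text \<open>The summands are the powers of \<omega> = exp (2 \<pi> i s / M), an M-th root of unity,
  so the geometric sum vanishes unless \<omega> = 1.\<close>

lemma sum_exp_root_of_unity:
  fixes s :: int and M :: nat
  assumes "M > 0"
  shows "(\<Sum>k=0..M - 1. exp (2 * of_int s * \<i> * (of_nat k * of_real pi / of_nat M)))
           = (if int M dvd s then of_nat M else (0::complex))"
proof -
  define \<omega> where "\<omega> = exp (2 * of_real pi * \<i> * of_int s / of_nat M)"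
  have pow: "exp (2 * of_int s * \<i> * (of_nat k * of_real pi / of_nat M)) = \<omega> ^ k" for k
    by (simp add: \<omega>_def exp_of_nat_mult [symmetric] algebra_simps)
  have one: "\<omega> = 1 \<longleftrightarrow> int M dvd s"
  proof -
    have "\<omega> = 1 \<longleftrightarrow> (\<exists>n::int. 2 * pi * of_int s / of_nat M = of_int (2 * n) * pi)"
      by (simp add: \<omega>_def exp_eq_1)
    also have "\<dots> \<longleftrightarrow> (\<exists>n::int. real_of_int s = of_int (int M * n))"
      using assms by (simp add: field_simps)
    also have "\<dots> \<longleftrightarrow> int M dvd s"
      unfolding of_int_eq_iff dvd_def ..
    finally show ?thesis .
  qed
  have "\<omega> ^ M = 1"
    using assms by (simp add: \<omega>_def exp_of_nat_mult [symmetric] exp_eq_1)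
  then have "(\<Sum>k<M. \<omega> ^ k) = (if \<omega> = 1 then of_nat M else 0)"
    by (simp add: sum_gp_strict)
  moreover have "{0..M - 1} = {..<M}"
    using assms by auto
  ultimately show ?thesis
    unfolding pow one by simp
qed

lemma infsum_sum:
  fixes f :: "'a \<Rightarrow> 'b \<Rightarrow> 'c :: {topological_comm_monoid_add, t2_space}"
  assumes "\<And>k. k \<in> I \<Longrightarrow> f k summable_on A"
  shows "(\<Sum>\<^sub>\<infinity>r\<in>A. \<Sum>k\<in>I. f k r) = (\<Sum>k\<in>I. \<Sum>\<^sub>\<infinity>r\<in>A. f k r)"
proof -
  have "((\<lambda>r. \<Sum>k\<in>I. f k r) has_sum (\<Sum>k\<in>I. \<Sum>\<^sub>\<infinity>r\<in>A. f k r)) A"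
    \<comment> \<open>An infinite \<open>I\<close> is covered as well: both sums over it take the
      default value 0.\<close>
    using assms by (induction I rule: infinite_finite_induct) (auto intro!: has_sum_add)
  then show ?thesis
    by (rule infsumI)
qed

theorem theorem3p1:
  fixes \<tau> z :: complex and m n :: nat and y :: "nat \<Rightarrow> complex"
  assumes "Im \<tau> > 0"
    and "even n" and "n > 0" and "m > 0"
    and "(\<Sum>j=1..n. y j) = 0"
  shows "(\<Sum>k=0..m * n - 1. \<Prod>j=1..n.
            jacobi_theta1 (z + y j + of_nat k * of_real pi / of_nat (m * n)) \<tau>)
         = R1 m n y \<tau> * jacobi_theta3 (of_nat (m * n) * z) (of_nat (m\<^sup>2 * n) * \<tau>)"
proof -

  \<comment> \<open>Expansion of the product over integer tuples\<close>
  define h where "h = n div 2"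
  have n: "n = 2 * h"
    using \<open>even n\<close> by (simp add: h_def)
  define M where "M = m * n"
  have "M > 0"
    using assms by (simp add: M_def)
  define P where "P = {1..n} \<rightarrow>\<^sub>E (UNIV :: int set)"
  define S where "S r = (\<Sum>j=1..n. r j)" for r :: "nat \<Rightarrow> int"
  \<comment> \<open>\<open>T\<close> is the index set of \<open>R1\<close>; \<open>D\<close>
    contains the tuples that survive the summation over k.\<close>
  define T where "T = {r \<in> P. S r = int h}"
  define D where "D = {r \<in> P. int M dvd S r + int h}"
  define G where "G r = (\<Prod>j=1..n. theta1_term \<tau> (z + y j) (r j))" for r
  define C where "C = (- \<i> * qpow \<tau> (1/4)) ^ n"
  \<comment> \<open>\<open>c\<close> and \<open>d\<close> are the general terms of the theta series
    on the right and of the series in \<open>R1\<close>.\<close>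
  define c where "c N = qpow (of_nat (m\<^sup>2 * n) * \<tau>) (of_int (N\<^sup>2)) *
      exp (of_int (2 * N) * \<i> * (of_nat M * z))" for N :: int
  define d where "d r = qpow \<tau> (of_int (\<Sum>j=1..n. (r j)\<^sup>2)) *
      exp (- 2 * \<i> * (\<Sum>j=1..n. of_int (r j) * y j))" for r :: "nat \<Rightarrow> int"
  have th1: "jacobi_theta1 w \<tau> = - \<i> * qpow \<tau> (1/4) * (\<Sum>\<^sub>\<infinity>r. theta1_term \<tau> w r)" for w
    by (simp add: jacobi_theta1_def theta1_term_def)
  have shift: "theta1_term \<tau> (w + v) r = theta1_term \<tau> w r * exp (of_int (2 * r + 1) * \<i> * v)" for w v r
    by (simp add: theta1_term_def exp_add [symmetric] algebra_simps)
  \<comment> \<open>A common shift v only contributes a character, because the exponents 2 r_j + 1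
    add up to 2 (S r + h).\<close>
  have prod_shift: "(\<Prod>j=1..n. theta1_term \<tau> (z + y j + v) (r j))
      = G r * exp (2 * of_int (S r + int h) * \<i> * v)" for r v
  proof -
    have "(\<Sum>j=1..n. of_int (2 * r j + 1) * \<i> * v) = of_int (\<Sum>j=1..n. 2 * r j + 1) * \<i> * v"
      by (simp add: sum_distrib_right)
    also have "(\<Sum>j=1..n. 2 * r j + 1) = 2 * (S r + int h)"
      by (simp add: S_def sum.distrib sum_distrib_left n)
    finally have "(\<Sum>j=1..n. of_int (2 * r j + 1) * \<i> * v) = 2 * of_int (S r + int h) * \<i> * v"
      by simp
    then show ?thesis
      by (simp add: shift prod.distrib G_def exp_sum [symmetric])
  qed
  have summ: "(\<lambda>r. \<Prod>j=1..n. theta1_term \<tau> (w j) (r j)) summable_on P" for w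
    unfolding P_def
    by (rule summable_on_prod_PiE_countable) (use theta1_term_abs_summable assms in auto)
  have prod_theta: "(\<Prod>j=1..n. jacobi_theta1 (w j) \<tau>)
      = C * (\<Sum>\<^sub>\<infinity>r\<in>P. \<Prod>j=1..n. theta1_term \<tau> (w j) (r j))" for w
  proof -
    have "(\<Sum>\<^sub>\<infinity>r\<in>P. \<Prod>j=1..n. theta1_term \<tau> (w j) (r j)) = (\<Prod>j=1..n. \<Sum>\<^sub>\<infinity>r. theta1_term \<tau> (w j) r)"
      unfolding P_def
      by (rule infsum_prod_PiE_abs) (use theta1_term_abs_summable assms in auto)
    then show ?thesis
      unfolding th1 C_def by (subst prod.distrib) simp
  qed

  \<comment> \<open>Reindexing of the surviving tuples by pairs (N, t)\<close>
  define i where "i = (\<lambda>(N, t). \<lambda>j\<in>{1..n}. int m * N - t j)"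
  \<comment> \<open>The inverse of \<open>i\<close>: on \<open>D\<close> the division is exact and
    recovers N. Restricting to \<open>{1..n}\<close> keeps the tuples extensional.\<close>
  define j where "j r = ((S r + int h) div int M,
      \<lambda>j\<in>{1..n}. int m * ((S r + int h) div int M) - r j)" for r
  have S_i: "S (i (N, t)) = int M * N - S t" for N t
    by (simp add: i_def S_def sum_subtractf M_def algebra_simps)
  have G_i: "(-1) ^ h * qpow \<tau> (- (real n / 2)) * (c N * d t) = G (i (N, t))" if "S t = int h" for N t
  proof -
    define r where "r = i (N, t)"
    have r: "r k = int m * N - t k" if "k \<in> {1..n}" for k
      using that by (simp add: r_def i_def)
    have Sr: "S r = int M * N - int h"
      using S_i [of N t] that by (simp add: r_def)
    \<comment> \<open>Evenness of n makes M N = 2 m h N even, so the sign does not depend on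
      N.\<close>
    have "(-1 :: complex) powi S r = (-1) powi (2 * (int (m * h) * N)) / (-1) powi int h"
      unfolding Sr by (subst power_int_diff [symmetric]) (simp_all add: M_def n algebra_simps)
    also have "(-1 :: complex) powi (2 * (int (m * h) * N)) = 1"
      by (subst power_int_mult) simp
    also have "1 / (-1 :: complex) powi int h = (-1) ^ h"
      by (simp add: field_simps power_mult_distrib [symmetric])
    finally have sign: "(-1 :: complex) powi S r = (-1) ^ h" .
    have "(\<Sum>k=1..n. r k * (r k + 1))
        = (\<Sum>k=1..n. (int m * N)\<^sup>2 + int m * N - (2 * (int m * N) + 1) * t k + (t k)\<^sup>2)"
      by (rule sum.cong) (simp_all add: r algebra_simps power2_eq_square)
    also have "\<dots> = int n * ((int m * N)\<^sup>2 + int m * N) - (2 * (int m * N) + 1) * S t + (\<Sum>k=1..n. (t k)\<^sup>2)"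
      unfolding S_def sum.distrib sum_subtractf sum_distrib_left by (simp add: distrib_left)
    \<comment> \<open>As S t = h and n = 2 h, the terms n m N and -2 m N h cancel; nothing mixing N
      and t remains.\<close>
    also have "\<dots> = int (m\<^sup>2 * n) * N\<^sup>2 + (\<Sum>k=1..n. (t k)\<^sup>2) - int h"
      unfolding that by (simp add: n algebra_simps power2_eq_square)
    finally have quad: "(\<Sum>k=1..n. r k * (r k + 1))
        = int (m\<^sup>2 * n) * N\<^sup>2 + (\<Sum>k=1..n. (t k)\<^sup>2) - int h" .
    have "(\<Sum>k=1..n. of_int (2 * r k + 1) * \<i> * (z + y k))
        = \<i> * (of_int (2 * S r + int n) * z + (2 * (of_nat m * of_int N) + 1) * (\<Sum>k=1..n. y k)
            - 2 * (\<Sum>k=1..n. of_int (t k) * y k))"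
    proof -
      have "(\<Sum>k=1..n. of_int (2 * r k + 1) * \<i> * (z + y k))
          = (\<Sum>k=1..n. \<i> * ((2 * of_int (r k) + 1) * z + (2 * (of_nat m * of_int N) + 1) * y k
              - 2 * (of_int (t k) * y k)))"
        by (rule sum.cong) (simp_all add: r algebra_simps)
      also have "\<dots> = \<i> * ((\<Sum>k=1..n. 2 * of_int (r k) + 1) * z + (2 * (of_nat m * of_int N) + 1) * (\<Sum>k=1..n. y k)
            - 2 * (\<Sum>k=1..n. of_int (t k) * y k))"
        unfolding sum_distrib_left [symmetric] sum_distrib_right [symmetric] sum.distrib sum_subtractf ..
      also have "(\<Sum>k=1..n. 2 * of_int (r k) + 1) = (of_int (2 * S r + int n) :: complex)"
        by (simp add: S_def sum.distrib sum_distrib_left)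
      finally show ?thesis .
    qed
    \<comment> \<open>The vanishing sum of the y_k removes the only term coupling N with y, and 2 S
      r + n = 2 M N.\<close>
    also have "\<dots> = of_int (2 * N) * \<i> * (of_nat M * z) + - 2 * \<i> * (\<Sum>k=1..n. of_int (t k) * y k)"
      unfolding Sr assms(5) by (simp add: n algebra_simps)
    finally have lin: "(\<Sum>k=1..n. of_int (2 * r k + 1) * \<i> * (z + y k)) = \<dots>" .
    have "G r = (-1) powi S r * qpow \<tau> (of_int (\<Sum>k=1..n. r k * (r k + 1)))
        * exp (\<Sum>k=1..n. of_int (2 * r k + 1) * \<i> * (z + y k))"
      unfolding G_def theta1_term_def S_def prod.distrib of_int_sum
      by (simp add: power_int_sum qpow_sum exp_sum)
    also have "\<dots> = (-1) ^ h * qpow \<tau> (of_nat (m\<^sup>2 * n) * of_int (N\<^sup>2)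
          + of_int (\<Sum>k=1..n. (t k)\<^sup>2) + - (real n / 2))
        * exp (of_int (2 * N) * \<i> * (of_nat M * z) + - 2 * \<i> * (\<Sum>k=1..n. of_int (t k) * y k))"
      unfolding sign quad lin by (simp add: n)
    also have "\<dots> = (-1) ^ h * qpow \<tau> (- (real n / 2)) * (c N * d t)"
      unfolding c_def d_def qpow_add exp_add qpow_of_nat_mult by simp
    finally show ?thesis
      by (simp add: r_def)
  qed
  define K where "K = (-1) ^ h * qpow \<tau> (- (real n / 2))"
  have "G summable_on D"
    by (rule summable_on_subset_banach [OF summ [of "\<lambda>j. z + y j", folded G_def]]) (auto simp: D_def)
  then have "(G has_sum (\<Sum>\<^sub>\<infinity>r\<in>D. G r)) D"
    by simp
  also have "?this \<longleftrightarrow> ((\<lambda>(N, t). K * (c N * d t)) has_sum (\<Sum>\<^sub>\<infinity>r\<in>D. G r)) (UNIV \<times> T)"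
  proof (rule has_sum_reindex_bij_witness [where j = j and i = i])
    fix r assume "r \<in> D"
    then have r: "r \<in> P" "int M dvd S r + int h"
      by (auto simp: D_def)
    show "i (j r) = r"
      using r(1) by (auto simp: i_def j_def P_def restrict_def PiE_def extensional_def)
    have "S (snd (j r)) = int M * fst (j r) - S r"
      by (simp add: j_def S_def sum_subtractf M_def algebra_simps)
    also have "\<dots> = int h"
      using r(2) by (simp add: j_def)
    finally show jr: "j r \<in> UNIV \<times> T"
      by (simp add: T_def P_def j_def)
    show "(case j r of (N, t) \<Rightarrow> K * (c N * d t)) = G r"
      unfolding K_def using G_i [of "snd (j r)" "fst (j r)"] jr \<open>i (j r) = r\<close> by (auto simp: T_def case_prod_beta)
  next
    fix b :: "int \<times> (nat \<Rightarrow> int)" assume "b \<in> UNIV \<times> T"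
    then obtain N t where b: "b = (N, t)" and t: "t \<in> P" "S t = int h"
      by (auto simp: T_def)
    have Si: "S (i b) + int h = int M * N"
      using S_i [of N t] t by (simp add: b)
    show "i b \<in> D"
      using Si by (simp add: D_def P_def i_def b)
    show "j (i b) = b"
      using t(1) \<open>M > 0\<close> unfolding j_def Si
      by (auto simp: i_def b P_def restrict_def PiE_def extensional_def)
  qed simp
  finally have hs: "((\<lambda>(N, t). K * (c N * d t)) has_sum (\<Sum>\<^sub>\<infinity>r\<in>D. G r)) (UNIV \<times> T)" .
  \<comment> \<open>Joint summability over the pairs is inherited from \<open>G\<close> on
    \<open>D\<close> through the bijection; this justifies the iterated sum.\<close>
  have "(\<Sum>\<^sub>\<infinity>r\<in>D. G r) = (\<Sum>\<^sub>\<infinity>N. \<Sum>\<^sub>\<infinity>t\<in>T. K * (c N * d t))"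
    using infsum_Sigma'_banach [OF has_sum_imp_summable [OF hs]] infsumI [OF hs] by simp
  also have "\<dots> = K * ((\<Sum>\<^sub>\<infinity>N. c N) * (\<Sum>\<^sub>\<infinity>t\<in>T. d t))"
    unfolding infsum_cmult_right' infsum_cmult_left' ..
  finally have sum_G: "(\<Sum>\<^sub>\<infinity>r\<in>D. G r) = K * ((\<Sum>\<^sub>\<infinity>N. c N) * (\<Sum>\<^sub>\<infinity>t\<in>T. d t))" .

  \<comment> \<open>Filtering by the sum over k and collecting the constants\<close>
  let ?v = "\<lambda>k. of_nat k * of_real pi / of_nat M :: complex"
  have "(\<Sum>k=0..M - 1. \<Prod>j=1..n. jacobi_theta1 (z + y j + ?v k) \<tau>)
      = C * (\<Sum>k=0..M - 1. \<Sum>\<^sub>\<infinity>r\<in>P. \<Prod>j=1..n. theta1_term \<tau> (z + y j + ?v k) (r j))"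
    unfolding prod_theta sum_distrib_left ..
  also have "(\<Sum>k=0..M - 1. \<Sum>\<^sub>\<infinity>r\<in>P. \<Prod>j=1..n. theta1_term \<tau> (z + y j + ?v k) (r j))
      = (\<Sum>\<^sub>\<infinity>r\<in>P. \<Sum>k=0..M - 1. \<Prod>j=1..n. theta1_term \<tau> (z + y j + ?v k) (r j))"
    by (rule infsum_sum [symmetric]) (rule summ)
  also have "\<dots> = (\<Sum>\<^sub>\<infinity>r\<in>P. G r * (if int M dvd S r + int h then of_nat M else 0))"
    unfolding prod_shift sum_distrib_left [symmetric] sum_exp_root_of_unity [OF \<open>M > 0\<close>] ..
  \<comment> \<open>Terms outside \<open>D\<close> vanish; the others gain the factor M, which is
    the m n in \<open>R1\<close>.\<close>
  also have "\<dots> = (\<Sum>\<^sub>\<infinity>r\<in>D. G r * of_nat M)"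
    by (rule infsum_cong_neutral) (auto simp: D_def)
  also have "\<dots> = (\<Sum>\<^sub>\<infinity>r\<in>D. G r) * of_nat M"
    by (rule infsum_cmult_left')
  also have "C * ((\<Sum>\<^sub>\<infinity>r\<in>D. G r) * of_nat M)
      = of_nat M * (C * K) * (\<Sum>\<^sub>\<infinity>t\<in>T. d t) * (\<Sum>\<^sub>\<infinity>N. c N)"
    by (simp add: sum_G algebra_simps)
  \<comment> \<open>The signs cancel since (-i)^(2 h) = (-1)^h, and the exponents give n/4 - n/2 =
    -n/4.\<close>
  also have "C * K = qpow \<tau> (- (real n / 4))"
  proof -
    have "C * K = ((- \<i>) ^ n * (-1) ^ h) * (qpow \<tau> (of_nat n * (1/4)) * qpow \<tau> (- (real n / 2)))"
      unfolding C_def K_def power_mult_distrib qpow_power by simp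
    also have "(- \<i>) ^ n * (-1) ^ h = (1 :: complex)"
      by (simp add: n power_mult power_mult_distrib [symmetric])
    finally show ?thesis
      by (simp add: qpow_add [symmetric])
  qed
  finally show ?thesis
    by (simp add: R1_def jacobi_theta3_def M_def c_def d_def T_def P_def S_def h_def)
qed

end
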